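(* Two LPMLN programs $P$ and $Q$ are q-strongly equivalent if and only if they are p-strongly equivalent.
   Context: All programs are finite and ground. A literal is an atom $a$ or its classical negation $\neg a$. An ASP rule $r$ has the form $l_1\vee\cdots\vee l_k\leftarrow l_{k+1},\dots,l_m,\ not\ l_{m+1},\dots,\ not\ l_n$ with literals $l_i$; write $h(r)$, $b^+(r)$, $b^-(r)$ for the head, positive body and negative body literal sets. An interpretation is a set of literals not containing both $a$ and $\neg a$ for any atom $a$. $I\models r$ iff ($b^+(r)\subseteq I$ and $b^-(r)\cap I=\emptyset$) implies $h(r)\cap I\neq\emptyset$. For an ASP program $\Pi$ the GL-reduct is $\Pi^I=\{h(r)\leftarrow b^+(r) : r\in\Pi,\ b^-(r)\cap I=\emptyset\}$, and $I$ is a stable model of $\Pi$ iff $I\models\Pi^I$ and no proper subset of $I$ satisfies $\Pi^I$. An LPMLN program $P$ is a finite set of weighted rules $w:r$, where $r$ is an ASP rule and $w$ is either a real number or the symbol $\alpha$ (hard rule); $\overline{P}=\{r : w:r\in P\}$. $P_I=\{w:r\in P : I\models r\}$; $I$ is a stable model of $P$ iff it is a stable model of $\overline{P_I}$; $\mathrm{SM}(P)$ is the set of stable models. $W(P,I)=\exp(\sum_{w:r\in P_I}w)$, a formal expression $\exp(a+b\alpha)$ in which $\alpha$ is regarded as an arbitrarily large positive quantity (so comparisons between weight degrees are made in this sense). $Pr(P,I)=\lim_{\alpha\to\infty}W(P,I)/\sum_{I'\in\mathrm{SM}(P)}W(P,I')$ if $I\in\mathrm{SM}(P)$, else $0$.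 $P,Q$ are p-strongly equivalent iff for every LPMLN program $R$, $\mathrm{SM}(P\cup R)=\mathrm{SM}(Q\cup R)$ and $Pr(P\cup R,X)=Pr(Q\cup R,X)$ for every $X\in\mathrm{SM}(P\cup R)$. $P,Q$ are q-strongly equivalent iff for every LPMLN program $R$, $\mathrm{SM}(P\cup R)=\mathrm{SM}(Q\cup R)$ and for all $X,Y\in\mathrm{SM}(P\cup R)$: $W(P\cup R,X)\le W(P\cup R,Y)$ iff $W(Q\cup R,X)\le W(Q\cup R,Y)$. *)

theory Defs
  imports Complex_Main "HOL-Library.Infinite_Typeclass"
begin

section \<open>Ground answer set programs\<close>

datatype 'a literal = Pos 'a | Neg 'a   \<comment> \<open>an atom or its classical negation\<close>

datatype 'a rule =
  Rule (head: "'a literal set") (pos_body: "'a literal set") (neg_body: "'a literal set")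

definition finite_rule :: "'a rule \<Rightarrow> bool" where
  "finite_rule r \<longleftrightarrow> finite (head r) \<and> finite (pos_body r) \<and> finite (neg_body r)"

definition interpretation_set :: "'a literal set \<Rightarrow> bool" where
  "interpretation_set I \<longleftrightarrow> (\<forall>a. \<not> (Pos a \<in> I \<and> Neg a \<in> I))"

definition sat_rule :: "'a literal set \<Rightarrow> 'a rule \<Rightarrow> bool" where
  "sat_rule I r \<longleftrightarrow>
     (pos_body r \<subseteq> I \<and> neg_body r \<inter> I = {} \<longrightarrow> head r \<inter> I \<noteq> {})"

definition sat_prog :: "'a literal set \<Rightarrow> 'a rule set \<Rightarrow> bool" where
  "sat_prog I \<Pi> \<longleftrightarrow> (\<forall>r\<in>\<Pi>. sat_rule I r)"

definition gl_reduct :: "'a rule set \<Rightarrow> 'a literal set \<Rightarrow> 'a rule set" where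
  "gl_reduct \<Pi> I = {Rule (head r) (pos_body r) {} | r. r \<in> \<Pi> \<and> neg_body r \<inter> I = {}}"

definition asp_stable :: "'a rule set \<Rightarrow> 'a literal set \<Rightarrow> bool" where
  "asp_stable \<Pi> I \<longleftrightarrow>
     interpretation_set I \<and> sat_prog I (gl_reduct \<Pi> I) \<and>
     (\<forall>J. J \<subset> I \<longrightarrow> \<not> sat_prog J (gl_reduct \<Pi> I))"


section \<open>LPMLN programs\<close>

datatype weight = Soft real | Hard   \<comment> \<open>\<open>Hard\<close> is the symbol \<open>\<alpha>\<close>\<close>

type_synonym 'a lpmln = "(weight \<times> 'a rule) set"

definition lpmln_program :: "'a lpmln \<Rightarrow> bool" where
  "lpmln_program P \<longleftrightarrow> finite P \<and> (\<forall>(w, r)\<in>P. finite_rule r)"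

definition unweighted :: "'a lpmln \<Rightarrow> 'a rule set" where
  "unweighted P = snd ` P"

definition satisfied_part :: "'a lpmln \<Rightarrow> 'a literal set \<Rightarrow> 'a lpmln" where
  "satisfied_part P I = {(w, r). (w, r) \<in> P \<and> sat_rule I r}"

definition SM :: "'a lpmln \<Rightarrow> 'a literal set set" where
  "SM P = {I. asp_stable (unweighted (satisfied_part P I)) I}"

text \<open>
  The formal expression \<open>exp (a + b * \<alpha>)\<close> is represented by the real function
  \<open>\<lambda>\<alpha>. exp (a + b * \<alpha>)\<close>. Two such expressions are compared for all sufficiently large \<open>\<alpha>\<close>.
\<close>

fun weight_value :: "weight \<Rightarrow> real \<Rightarrow> real" where
  "weight_value (Soft w) \<alpha> = w"
| "weight_value Hard \<alpha> = \<alpha>"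

definition weight_degree :: "'a lpmln \<Rightarrow> 'a literal set \<Rightarrow> real \<Rightarrow> real" where
  "weight_degree P I = (\<lambda>\<alpha>. exp (\<Sum>(w, r)\<in>satisfied_part P I. weight_value w \<alpha>))"

definition degree_le :: "(real \<Rightarrow> real) \<Rightarrow> (real \<Rightarrow> real) \<Rightarrow> bool" where
  "degree_le f g \<longleftrightarrow> (\<forall>\<^sub>F \<alpha> in at_top. f \<alpha> \<le> g \<alpha>)"

definition prob_degree :: "'a lpmln \<Rightarrow> 'a literal set \<Rightarrow> real" where
  "prob_degree P I =
     (if I \<in> SM P
      then Lim at_top (\<lambda>\<alpha>. weight_degree P I \<alpha> / (\<Sum>I'\<in>SM P. weight_degree P I' \<alpha>))
      else 0)"


section \<open>Strong equivalences\<close>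

definition p_strongly_equivalent :: "'a lpmln \<Rightarrow> 'a lpmln \<Rightarrow> bool" where
  "p_strongly_equivalent P Q \<longleftrightarrow>
     (\<forall>R. lpmln_program R \<longrightarrow>
        SM (P \<union> R) = SM (Q \<union> R) \<and>
        (\<forall>X\<in>SM (P \<union> R). prob_degree (P \<union> R) X = prob_degree (Q \<union> R) X))"

definition q_strongly_equivalent :: "'a lpmln \<Rightarrow> 'a lpmln \<Rightarrow> bool" where
  "q_strongly_equivalent P Q \<longleftrightarrow>
     (\<forall>R. lpmln_program R \<longrightarrow>
        SM (P \<union> R) = SM (Q \<union> R) \<and>
        (\<forall>X\<in>SM (P \<union> R). \<forall>Y\<in>SM (P \<union> R).
           degree_le (weight_degree (P \<union> R) X) (weight_degree (P \<union> R) Y) \<longleftrightarrow>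
           degree_le (weight_degree (Q \<union> R) X) (weight_degree (Q \<union> R) Y)))"

text \<open>
  Results about these equivalences are stated for an infinite type of atoms
  (\<open>'a::infinite\<close>): a context program \<open>R\<close> may use atoms that do not occur in \<open>P\<close> or \<open>Q\<close>. Over a
  finite vocabulary there are only finitely many hard rules, and the two notions differ: with two
  atoms \<open>a\<close>, \<open>b\<close>, add to all hard rules the rule \<open>\<leftarrow> a, not b, not \<not>b\<close>, once with
  weight 1 and once with weight 2. The results are p- but not q-strongly equivalent.
\<close>

end

theory Submission
  imports Defs
begin

text \<open>
  Both equivalences amount to proportionality: in every context the two programs have the same
  stable models, and their weight degrees differ by a common factor. To see that proportionality
  is necessary, absorb the context into \<open>P\<close> and \<open>Q\<close>. Then add facts of weight 0, which turn all
  consistent subsets of a finite vocabulary into stable models, and penalise each of these by its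
  own weight in \<open>P\<close>. Now all stable models have the same weight in \<open>P\<close>, so that the order
  (respectively the uniform distribution) carries over to \<open>Q\<close> and forces the weights there to be
  equal, too.
\<close>

section \<open>Stable models of LPMLN programs\<close>

lemma lpmln_program_Un: "lpmln_program P \<Longrightarrow> lpmln_program Q \<Longrightarrow> lpmln_program (P \<union> Q)"
  unfolding lpmln_program_def by auto

text \<open>By minimality: cutting \<open>I\<close> down to the literals in heads keeps the reduct
  satisfied, since positive bodies only become harder to meet and no head loses a literal of
  \<open>I\<close>.\<close>

lemma stable_subset_heads:
  assumes "asp_stable \<Pi> I"
  shows "I \<subseteq> (\<Union>r\<in>\<Pi>. head r)"
proof -
  let ?J = "I \<inter> (\<Union>r\<in>\<Pi>. head r)"
  have "sat_rule ?J r'" if "r' \<in> gl_reduct \<Pi> I" for r'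
  proof -
    from that obtain r where r: "r \<in> \<Pi>" "r' = Rule (head r) (pos_body r) {}"
      unfolding gl_reduct_def by blast
    moreover have "sat_rule I r'"
      using assms that unfolding asp_stable_def sat_prog_def by blast
    ultimately show ?thesis
      unfolding sat_rule_def by auto
  qed
  then have "\<not> ?J \<subset> I"
    using assms unfolding asp_stable_def sat_prog_def by blast
  then show ?thesis by blast
qed

lemma SM_subset_heads:
  assumes "\<And>w r. (w, r) \<in> P \<Longrightarrow> head r \<subseteq> V"
  shows "SM P \<subseteq> {Z. Z \<subseteq> V \<and> interpretation_set Z}"
proof
  fix I assume "I \<in> SM P"
  then have st: "asp_stable (unweighted (satisfied_part P I)) I"
    by (simp add: SM_def)
  have "(\<Union>r\<in>unweighted (satisfied_part P I). head r) \<subseteq> V"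
    using assms unfolding unweighted_def satisfied_part_def by fastforce
  with stable_subset_heads[OF st] st show "I \<in> {Z. Z \<subseteq> V \<and> interpretation_set Z}"
    by (auto simp: asp_stable_def)
qed

lemma heads_finite:
  assumes "lpmln_program P"
  shows "finite (\<Union>(w, r)\<in>P. head r)" "finite (\<Union>(w, r)\<in>P. neg_body r)"
  using assms unfolding lpmln_program_def finite_rule_def by auto

text \<open>Ensures that the normalising sum in \<open>prob_degree\<close> is a genuine one; over an
  infinite set it would default to 0.\<close>

lemma finite_SM:
  assumes "lpmln_program P"
  shows "finite (SM P)"
proof (rule finite_subset)
  let ?V = "\<Union>(w, r)\<in>P. head r"
  show "SM P \<subseteq> Pow ?V"
    using SM_subset_heads[of P ?V] by blast
  show "finite (Pow ?V)"
    using heads_finite(1)[OF assms] by simp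
qed

text \<open>A violated rule is simply ignored, so weighted facts act as a choice.\<close>

lemma SM_of_choice_facts:
  assumes heads: "\<And>w r. (w, r) \<in> P \<Longrightarrow> head r \<subseteq> V"
    and facts: "\<And>l. l \<in> V \<Longrightarrow> \<exists>w. (w, Rule {l} {} {c}) \<in> P"
    and c: "c \<notin> V"
  shows "SM P = {Z. Z \<subseteq> V \<and> interpretation_set Z}"
proof
  show "SM P \<subseteq> {Z. Z \<subseteq> V \<and> interpretation_set Z}"
    using heads by (rule SM_subset_heads)
  show "{Z. Z \<subseteq> V \<and> interpretation_set Z} \<subseteq> SM P"
  proof
    fix Z assume "Z \<in> {Z. Z \<subseteq> V \<and> interpretation_set Z}"
    then have Z: "Z \<subseteq> V" "interpretation_set Z" by auto
    let ?\<Pi> = "unweighted (satisfied_part P Z)"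
    \<comment> \<open>Automatic, because \<open>satisfied_part\<close> has already discarded every
      rule that \<open>Z\<close> violates.\<close>
    have "sat_prog Z (gl_reduct ?\<Pi> Z)"
      unfolding sat_prog_def gl_reduct_def unweighted_def satisfied_part_def sat_rule_def by auto
    moreover have "\<not> sat_prog J (gl_reduct ?\<Pi> Z)" if "J \<subset> Z" for J
    proof -
      \<comment> \<open>The fact for a literal missing from \<open>J\<close> survives in the reduct,
        as \<open>c\<close> is false in \<open>Z\<close>, and \<open>J\<close> violates it.\<close>
      from that obtain l where l: "l \<in> Z" "l \<notin> J" by blast
      with Z facts obtain w where "(w, Rule {l} {} {c}) \<in> P" by blast
      with l have "Rule {l} {} {c} \<in> ?\<Pi>"
        unfolding unweighted_def satisfied_part_def sat_rule_def by force
      moreover have "c \<notin> Z" using c Z by blast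
      ultimately have "Rule {l} {} {} \<in> gl_reduct ?\<Pi> Z"
        unfolding gl_reduct_def by force
      moreover have "\<not> sat_rule J (Rule {l} {} {})"
        using l by (simp add: sat_rule_def)
      ultimately show ?thesis unfolding sat_prog_def by blast
    qed
    ultimately show "Z \<in> SM P"
      using Z by (simp add: SM_def asp_stable_def)
  qed
qed

section \<open>Exponents of weight degrees\<close>

definition exponent :: "'a lpmln \<Rightarrow> 'a literal set \<Rightarrow> real \<Rightarrow> real" where
  "exponent P I \<alpha> = (\<Sum>(w, r)\<in>P. if sat_rule I r then weight_value w \<alpha> else 0)"

text \<open>Hard rules contribute nothing at \<open>\<alpha> = 0\<close>, so this is the constant
  term of the exponent.\<close>

definition soft_weight :: "'a lpmln \<Rightarrow> 'a literal set \<Rightarrow> real" where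
  "soft_weight P I = exponent P I 0"

definition hard_count :: "'a lpmln \<Rightarrow> 'a literal set \<Rightarrow> nat" where
  "hard_count P I = (\<Sum>(w, r)\<in>P. of_bool (sat_rule I r \<and> w = Hard))"

lemma weight_degree_eq:
  assumes "finite P"
  shows "weight_degree P I \<alpha> = exp (exponent P I \<alpha>)"
proof -
  have "satisfied_part P I = {x \<in> P. sat_rule I (snd x)}"
    unfolding satisfied_part_def by auto
  then show ?thesis
    using assms by (simp add: weight_degree_def exponent_def sum.inter_filter case_prod_beta)
qed

lemma exponent_eq: "exponent P I \<alpha> = soft_weight P I + real (hard_count P I) * \<alpha>"
proof -
  have "(if sat_rule I r then weight_value w \<alpha> else 0) =
      (if sat_rule I r then weight_value w 0 else 0) + of_bool (sat_rule I r \<and> w = Hard) * \<alpha>"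
    for w and r :: "'a rule"
    by (cases w) auto
  then show ?thesis
    unfolding soft_weight_def exponent_def hard_count_def
    by (simp add: case_prod_beta sum.distrib sum_distrib_right)
qed

text \<open>Programs are sets: a weighted rule common to both would be counted only once in the
  union.\<close>

lemma exponent_Un_disjoint:
  assumes "finite P" "finite Q" "P \<inter> Q = {}"
  shows "exponent (P \<union> Q) I \<alpha> = exponent P I \<alpha> + exponent Q I \<alpha>"
  using assms unfolding exponent_def by (rule sum.union_disjoint)

section \<open>Penalising single interpretations\<close>

text \<open>
  Literals \<open>d i\<close> outside \<open>V\<close> are false in all interpretations considered. They make the rules
  different from those of a given program, and yield several copies of one hard constraint.
\<close>

definition penalty_program ::
    "'a literal set \<Rightarrow> (nat \<Rightarrow> 'a literal) \<Rightarrow> ('a literal set \<Rightarrow> real) \<Rightarrow>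
     ('a literal set \<Rightarrow> nat) \<Rightarrow> 'a lpmln" where
  "penalty_program V d s h =
     (\<lambda>l. (Soft 0, Rule {l} {} {d 0})) ` V \<union>
     (\<lambda>(Z, i). (if i = 0 then Soft (s Z) else Hard, Rule {} Z (insert (d i) (V - Z))))
       ` (SIGMA Z:Pow V. {..h Z})"

lemma lpmln_program_penalty:
  assumes "finite V"
  shows "lpmln_program (penalty_program V d s h)"
proof -
  have "finite (SIGMA Z:Pow V. {..h Z})"
    using assms by (intro finite_SigmaI) auto
  then show ?thesis
    using assms unfolding lpmln_program_def penalty_program_def finite_rule_def
    by (auto intro: finite_subset[OF _ assms])
qed

text \<open>Among the subsets of \<open>V\<close>, only \<open>Z\<close> violates the constraints
  built from \<open>Z\<close>, so exactly their weight is missing from the total; the facts weigh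
  0.\<close>

lemma exponent_penalty:
  assumes V: "finite V" and d: "inj d" "range d \<inter> V = {}" and Z: "Z \<subseteq> V"
  shows "exponent (penalty_program V d s h) Z \<alpha> =
    (\<Sum>Z'\<in>Pow V. s Z' + real (h Z') * \<alpha>) - (s Z + real (h Z) * \<alpha>)"
proof -
  let ?f = "\<lambda>l. (Soft 0, Rule {l} {} {d 0})"
  let ?g = "\<lambda>(Z, i). (if i = 0 then Soft (s Z) else Hard, Rule {} Z (insert (d i) (V - Z)))"
  let ?S = "SIGMA Z:Pow V. {..h Z}"
  let ?val = "\<lambda>(w, r). if sat_rule Z r then weight_value w \<alpha> else 0"
  have finS: "finite ?S"
    using V by (intro finite_SigmaI) auto
  have dV: "d i \<notin> V" for i
    using d(2) by auto
  \<comment> \<open>Keeps the copies from collapsing in the set: the positive body recovers the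
    interpretation, and \<open>d i\<close> is the only literal of the negative body outside
    \<open>V\<close>.\<close>
  have inj: "inj_on ?g ?S"
  proof (rule inj_onI)
    fix x y assume "?g x = ?g y"
    then have "fst x = fst y" "insert (d (snd x)) (V - fst x) = insert (d (snd y)) (V - fst y)"
      by (auto simp: case_prod_beta)
    moreover from this have "d (snd x) = d (snd y)" using dV by blast
    ultimately show "x = y" using d(1) by (simp add: prod_eq_iff inj_eq)
  qed
  \<comment> \<open>The body holds iff \<open>A\<close> is included in \<open>Z\<close> and
    \<open>Z\<close> misses \<open>V - A\<close>, which inside \<open>V\<close> means
    \<open>Z = A\<close>.\<close>
  have sat: "sat_rule Z (Rule {} A (insert (d i) (V - A))) \<longleftrightarrow> A \<noteq> Z" if "A \<subseteq> V" for A i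
  proof -
    have "d i \<notin> Z" using dV Z by blast
    then show ?thesis using that Z unfolding sat_rule_def by auto
  qed
  \<comment> \<open>Index 0 is the soft copy, indices 1 to \<open>h A\<close> are the hard
    ones.\<close>
  have copies: "(\<Sum>i\<le>h A. weight_value (if i = 0 then Soft (s A) else Hard) \<alpha>) =
      s A + real (h A) * \<alpha>" for A
    by (simp add: sum.atMost_shift)
  have "exponent (penalty_program V d s h) Z \<alpha> = sum ?val (?f ` V) + sum ?val (?g ` ?S)"
    unfolding exponent_def penalty_program_def
    using V finS by (intro sum.union_disjoint) auto
  also have "sum ?val (?f ` V) = 0"
    by (intro sum.neutral) auto
  also have "sum ?val (?g ` ?S) = (\<Sum>(A, i)\<in>?S. ?val (?g (A, i)))"
    by (subst sum.reindex[OF inj]) (auto intro: sum.cong)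
  also have "\<dots> = (\<Sum>A\<in>Pow V. \<Sum>i\<le>h A. ?val (?g (A, i)))"
    using V by (subst sum.Sigma) auto
  also have "\<dots> = (\<Sum>A\<in>Pow V. if A = Z then 0 else s A + real (h A) * \<alpha>)"
    by (intro sum.cong refl) (auto simp: sat copies)
  also have "\<dots> = (\<Sum>A\<in>Pow V. (s A + real (h A) * \<alpha>) -
      (if A = Z then s A + real (h A) * \<alpha> else 0))"
    by (intro sum.cong) auto
  also have "\<dots> = (\<Sum>A\<in>Pow V. s A + real (h A) * \<alpha>) - (s Z + real (h Z) * \<alpha>)"
    using V Z by (simp add: sum_subtractf sum.delta)
  finally show ?thesis by simp
qed

text \<open>Flattens the weights of \<open>P\<close>, so that those of \<open>Q\<close> show exactly
  the difference of the exponents.\<close>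

lemma levelling_context:
  fixes P Q :: "('a::infinite) lpmln"
  assumes P: "lpmln_program P" and Q: "lpmln_program Q"
  obtains R k where "lpmln_program R" "SM (P \<union> R) = SM (Q \<union> R)"
    "SM P \<subseteq> SM (P \<union> R)"
    "\<And>Z \<alpha>. Z \<in> SM (P \<union> R) \<Longrightarrow> weight_degree (P \<union> R) Z \<alpha> = exp (k \<alpha>)"
    "\<And>Z \<alpha>. Z \<in> SM (P \<union> R) \<Longrightarrow>
       weight_degree (Q \<union> R) Z \<alpha> = exp (k \<alpha> + (exponent Q Z \<alpha> - exponent P Z \<alpha>))"
proof -
  note PQ = lpmln_program_Un[OF P Q]
  define V where "V = (\<Union>(w, r)\<in>P \<union> Q. head r)"
  define N where "N = (\<Union>(w, r)\<in>P \<union> Q. neg_body r)"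
  have finV: "finite V" and finN: "finite N"
    unfolding V_def N_def using heads_finite[OF PQ] by auto
  \<comment> \<open>Infinitely many atoms leave infinitely many literals outside the finite sets
    \<open>V\<close> and \<open>N\<close>, which supplies the fresh \<open>d i\<close>.\<close>
  have "inj (Pos :: 'a \<Rightarrow> 'a literal)"
    by (auto intro: injI)
  then have "infinite (UNIV :: 'a literal set)"
    using infinite_UNIV finite_imageD finite_subset subset_UNIV by metis
  then have "infinite (UNIV - (V \<union> N))"
    using finV finN by (simp add: Diff_infinite_finite)
  then obtain d :: "nat \<Rightarrow> 'a literal" where d: "inj d" "range d \<subseteq> UNIV - (V \<union> N)"
    using infinite_countable_subset by blast
  define R where "R = penalty_program V d (soft_weight P) (hard_count P)"
  have R: "lpmln_program R"
    unfolding R_def using finV by (rule lpmln_program_penalty)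
  have fin: "finite P" "finite Q" "finite R"
    using P Q R by (auto simp: lpmln_program_def)
  have heads: "head r \<subseteq> V" if "(w, r) \<in> P \<union> Q \<union> R" for w r
    using that unfolding V_def R_def penalty_program_def by auto
  have facts: "(Soft 0, Rule {l} {} {d 0}) \<in> R" if "l \<in> V" for l
    using that unfolding R_def penalty_program_def by auto
  have d0: "d 0 \<notin> V" and dV: "range d \<inter> V = {}" using d by auto
  have SMP: "SM (P \<union> R) = {Z. Z \<subseteq> V \<and> interpretation_set Z}"
    using heads facts d0 by (intro SM_of_choice_facts[where c = "d 0"]) blast+
  have SMQ: "SM (Q \<union> R) = {Z. Z \<subseteq> V \<and> interpretation_set Z}"
    using heads facts d0 by (intro SM_of_choice_facts[where c = "d 0"]) blast+
  \<comment> \<open>The fresh literals in negative bodies tell \<open>R\<close> apart from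
    \<open>P\<close> and \<open>Q\<close>, so that exponents add up over the unions.\<close>
  have "range d \<inter> neg_body r \<noteq> {}" if "(w, r) \<in> R" for w r
    using that unfolding R_def penalty_program_def by auto
  moreover have "range d \<inter> neg_body r = {}" if "(w, r) \<in> P \<union> Q" for w r
    using that d(2) unfolding N_def by fastforce
  ultimately have disj: "P \<inter> R = {}" "Q \<inter> R = {}"
    by fastforce+
  \<comment> \<open>The total of all penalties. At \<open>Z\<close> the context lacks
    \<open>exponent P Z\<close> of it, which is just what \<open>P\<close> supplies.\<close>
  define k where "k \<alpha> = (\<Sum>Z\<in>Pow V. exponent P Z \<alpha>)" for \<alpha>
  have ex: "exponent R Z \<alpha> = k \<alpha> - exponent P Z \<alpha>" if "Z \<in> SM (P \<union> R)" for Z \<alpha>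
  proof -
    have "Z \<subseteq> V" using that by (simp add: SMP)
    then show ?thesis
      unfolding R_def k_def exponent_eq[of P] by (rule exponent_penalty[OF finV d(1) dV])
  qed
  show thesis
  proof (rule that[OF R])
    show "SM (P \<union> R) = SM (Q \<union> R)" by (simp add: SMP SMQ)
    show "SM P \<subseteq> SM (P \<union> R)"
      unfolding SMP using heads by (intro SM_subset_heads) blast
  next
    fix Z \<alpha> assume Z: "Z \<in> SM (P \<union> R)"
    show "weight_degree (P \<union> R) Z \<alpha> = exp (k \<alpha>)"
      using fin disj by (simp add: weight_degree_eq exponent_Un_disjoint ex[OF Z])
    show "weight_degree (Q \<union> R) Z \<alpha> = exp (k \<alpha> + (exponent Q Z \<alpha> - exponent P Z \<alpha>))"
      using fin disj by (simp add: weight_degree_eq exponent_Un_disjoint ex[OF Z])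
  qed
qed

section \<open>Asymptotics of affine functions and their exponentials\<close>

text \<open>Two points beyond the threshold determine an affine function. This turns equality of
  exponents for large \<open>\<alpha>\<close> into equality for every
  \<open>\<alpha>\<close>.\<close>

lemma eventually_linear_eqD:
  fixes a b c d :: real
  assumes "\<forall>\<^sub>F t in at_top. a + b * t = c + d * t"
  shows "a = c \<and> b = d"
proof -
  obtain T where T: "\<And>t. t \<ge> T \<Longrightarrow> a + b * t = c + d * t"
    using assms unfolding eventually_at_top_linorder by blast
  have "a + b * T = c + d * T" "a + b * (T + 1) = c + d * (T + 1)"
    using T by auto
  moreover from this have "b = d" by (simp add: distrib_left)
  ultimately show ?thesis by simp
qed

text \<open>The limit is 0 for negative slope and \<open>exp a\<close> for slope 0.\<close>

lemma tendsto_exp_linear_nonpos: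
  fixes a b :: real
  assumes "b < 0 \<or> b = 0 \<and> a \<le> 0"
  obtains l where "((\<lambda>t. exp (a + b * t)) \<longlongrightarrow> l) at_top" "0 \<le> l" "l \<le> 1"
    "l = 1 \<Longrightarrow> a = 0 \<and> b = 0"
proof (cases "b < 0")
  case True
  have "filterlim (\<lambda>t. a + b * t) at_bot at_top"
    using True filterlim_tendsto_neg_mult_at_bot[OF tendsto_const _ filterlim_ident]
    by (simp add: filterlim_tendsto_add_at_bot_iff[OF tendsto_const])
  then have "((\<lambda>t. exp (a + b * t)) \<longlongrightarrow> 0) at_top"
    by (rule filterlim_compose[OF exp_at_bot])
  then show ?thesis by (rule that) auto
next
  case False
  with assms have "b = 0" "a \<le> 0" by auto
  then show ?thesis by (intro that[of "exp a"]) auto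
qed

text \<open>
  For a lexicographically largest pair \<open>(b X, a X)\<close>, each summand of the inverse probability has
  a limit of at most 1, so the limit is \<open>card C\<close> only if all pairs agree.
\<close>

lemma uniform_limits_imp_equal:
  fixes a b :: "'i \<Rightarrow> real"
  assumes C: "finite C"
    and lim: "\<And>X. X \<in> C \<Longrightarrow>
      Lim at_top (\<lambda>t. exp (a X + b X * t) / (\<Sum>Z\<in>C. exp (a Z + b Z * t))) = 1 / card C"
    and "X \<in> C" "Y \<in> C"
  shows "a X = a Y \<and> b X = b Y"
proof -
  define B where "B = Max (b ` C)"
  define C' where "C' = {Z \<in> C. b Z = B}"
  have "B \<in> b ` C"
    unfolding B_def using C \<open>X \<in> C\<close> by (intro Max_in) auto
  then have "C' \<noteq> {}" unfolding C'_def by auto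
  moreover have "finite C'" unfolding C'_def using C by auto
  ultimately have "Max (a ` C') \<in> a ` C'" "\<And>Z. Z \<in> C' \<Longrightarrow> a Z \<le> Max (a ` C')"
    by (auto intro: Max_in)
  then obtain M where M: "M \<in> C'" "\<And>Z. Z \<in> C' \<Longrightarrow> a Z \<le> a M"
    by (metis imageE)
  have MC: "M \<in> C" "b M = B" using M(1) by (auto simp: C'_def)
  have top: "b Z - b M < 0 \<or> b Z - b M = 0 \<and> a Z - a M \<le> 0" if "Z \<in> C" for Z
  proof -
    have "b Z \<le> B" unfolding B_def using C that by auto
    then show ?thesis using M(2)[of Z] that MC by (auto simp: C'_def)
  qed
  have "\<forall>Z\<in>C. \<exists>l. ((\<lambda>t. exp ((a Z - a M) + (b Z - b M) * t)) \<longlongrightarrow> l) at_top \<and> 0 \<le> l \<and> l \<le> 1 \<and>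
      (l = 1 \<longrightarrow> a Z - a M = 0 \<and> b Z - b M = 0)"
    using tendsto_exp_linear_nonpos[OF top] by metis
  then obtain l where l: "\<And>Z. Z \<in> C \<Longrightarrow> ((\<lambda>t. exp ((a Z - a M) + (b Z - b M) * t)) \<longlongrightarrow> l Z) at_top"
    "\<And>Z. Z \<in> C \<Longrightarrow> 0 \<le> l Z" "\<And>Z. Z \<in> C \<Longrightarrow> l Z \<le> 1"
    "\<And>Z. Z \<in> C \<Longrightarrow> l Z = 1 \<Longrightarrow> a Z - a M = 0 \<and> b Z - b M = 0"
    by metis
  have "l M = 1"
    using l(1)[OF MC(1)] by (simp add: tendsto_const_iff)
  then have pos: "sum l C > 0"
    using C MC l(2) by (intro sum_pos2[of C M]) auto
  \<comment> \<open>Dividing by the dominant term, that of \<open>M\<close>, leaves summands with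
    finite limits.\<close>
  have "exp (a M + b M * t) / (\<Sum>Z\<in>C. exp (a Z + b Z * t)) =
      1 / (\<Sum>Z\<in>C. exp ((a Z - a M) + (b Z - b M) * t))" for t
  proof -
    have "(\<Sum>Z\<in>C. exp (a Z + b Z * t)) =
        exp (a M + b M * t) * (\<Sum>Z\<in>C. exp ((a Z - a M) + (b Z - b M) * t))"
      unfolding sum_distrib_left
      by (intro sum.cong refl) (simp flip: exp_add add: algebra_simps)
    then show ?thesis by simp
  qed
  moreover have "((\<lambda>t. 1 / (\<Sum>Z\<in>C. exp ((a Z - a M) + (b Z - b M) * t))) \<longlongrightarrow> 1 / sum l C) at_top"
    using pos l(1) by (intro tendsto_intros) auto
  ultimately have "Lim at_top (\<lambda>t. exp (a M + b M * t) / (\<Sum>Z\<in>C. exp (a Z + b Z * t))) = 1 / sum l C"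
    by (simp add: tendsto_Lim)
  then have "sum l C = card C"
    using lim[OF MC(1)] by simp
  then have "(\<Sum>Z\<in>C. 1 - l Z) = 0"
    by (simp add: sum_subtractf)
  then have "l Z = 1" if "Z \<in> C" for Z
    using that C l(3) by (simp add: sum_nonneg_eq_0_iff)
  then have "a Z = a M \<and> b Z = b M" if "Z \<in> C" for Z
    using l(4) that by force
  then show ?thesis using assms(3,4) by simp
qed

section \<open>Proportional weight degrees\<close>

text \<open>A common factor between the weights of \<open>P\<close> and \<open>Q\<close>,
  cross-multiplied so that it need not be named. It may depend on \<open>\<alpha>\<close>.\<close>

definition proportional :: "'a lpmln \<Rightarrow> 'a lpmln \<Rightarrow> bool" where
  "proportional P Q \<longleftrightarrow> SM P = SM Q \<and>
     (\<forall>X\<in>SM P. \<forall>Y\<in>SM P. \<forall>\<alpha>.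
        weight_degree P X \<alpha> * weight_degree Q Y \<alpha> = weight_degree P Y \<alpha> * weight_degree Q X \<alpha>)"

lemma weight_degree_pos: "weight_degree P X \<alpha> > 0"
  by (simp add: weight_degree_def)

text \<open>Weights are positive, so the order is read off from whether their ratio is at most 1,
  and the ratios agree.\<close>

lemma proportional_imp_degree_le_iff:
  assumes "proportional P Q" "X \<in> SM P" "Y \<in> SM P"
  shows "degree_le (weight_degree P X) (weight_degree P Y) \<longleftrightarrow>
    degree_le (weight_degree Q X) (weight_degree Q Y)"
proof -
  have "weight_degree P X \<alpha> \<le> weight_degree P Y \<alpha> \<longleftrightarrow>
      weight_degree Q X \<alpha> \<le> weight_degree Q Y \<alpha>" for \<alpha>
  proof -
    have "weight_degree P X \<alpha> * weight_degree Q Y \<alpha> = weight_degree P Y \<alpha> * weight_degree Q X \<alpha>"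
      using assms by (simp add: proportional_def)
    moreover have "weight_degree P Y \<alpha> > 0" "weight_degree Q Y \<alpha> > 0"
      by (rule weight_degree_pos)+
    ultimately have "weight_degree P X \<alpha> / weight_degree P Y \<alpha> =
        weight_degree Q X \<alpha> / weight_degree Q Y \<alpha>"
      by (simp add: frac_eq_eq mult.commute)
    then show ?thesis
      using weight_degree_pos by (metis divide_le_eq_1_pos)
  qed
  then show ?thesis by (simp add: degree_le_def)
qed

text \<open>The common factor cancels in the quotient for each \<open>\<alpha>\<close>, before any
  limit is taken.\<close>

lemma proportional_imp_prob_degree_eq:
  assumes pr: "proportional P Q" and "lpmln_program P" and X: "X \<in> SM P"
  shows "prob_degree P X = prob_degree Q X"
proof -
  have SM: "SM Q = SM P" using pr by (simp add: proportional_def)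
  have fin: "finite (SM P)" using assms(2) by (rule finite_SM)
  have "weight_degree P X \<alpha> / (\<Sum>I\<in>SM P. weight_degree P I \<alpha>) =
      weight_degree Q X \<alpha> / (\<Sum>I\<in>SM P. weight_degree Q I \<alpha>)" for \<alpha>
  proof -
    have "weight_degree P X \<alpha> * (\<Sum>I\<in>SM P. weight_degree Q I \<alpha>) =
        weight_degree Q X \<alpha> * (\<Sum>I\<in>SM P. weight_degree P I \<alpha>)"
      unfolding sum_distrib_left using pr X
      by (intro sum.cong refl) (simp add: proportional_def mult.commute)
    moreover have "(\<Sum>I\<in>SM P. weight_degree R I \<alpha>) > 0" for R
      using fin X by (intro sum_pos) (auto simp: weight_degree_pos)
    ultimately show ?thesis
      by (simp add: frac_eq_eq less_imp_neq[symmetric])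
  qed
  then show ?thesis using X by (simp add: prob_degree_def SM)
qed

text \<open>The exponential of the constant difference is the common factor.\<close>

lemma proportional_if_exponent_diff_eq:
  assumes "lpmln_program P" "lpmln_program Q" "SM P = SM Q"
    and diff: "\<And>X Y \<alpha>. X \<in> SM P \<Longrightarrow> Y \<in> SM P \<Longrightarrow>
      exponent Q X \<alpha> - exponent P X \<alpha> = exponent Q Y \<alpha> - exponent P Y \<alpha>"
  shows "proportional P Q"
proof -
  have "finite P" "finite Q" using assms by (auto simp: lpmln_program_def)
  moreover have "exponent P X \<alpha> + exponent Q Y \<alpha> = exponent P Y \<alpha> + exponent Q X \<alpha>"
    if "X \<in> SM P" "Y \<in> SM P" for X Y \<alpha>
    using diff[OF that, of \<alpha>] by simp
  ultimately show ?thesis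
    using assms(3) by (simp add: proportional_def weight_degree_eq flip: exp_add)
qed

lemma exponent_diff_eq:
  "exponent Q X \<alpha> - exponent P X \<alpha> =
     (soft_weight Q X - soft_weight P X) + (real (hard_count Q X) - real (hard_count P X)) * \<alpha>"
  by (simp add: exponent_eq algebra_simps)

lemma q_strongly_equivalent_imp_proportional:
  fixes P Q :: "('a::infinite) lpmln"
  assumes P: "lpmln_program P" and Q: "lpmln_program Q" and q: "q_strongly_equivalent P Q"
  shows "proportional P Q"
proof -
  obtain R k where R: "lpmln_program R" "SM (P \<union> R) = SM (Q \<union> R)" "SM P \<subseteq> SM (P \<union> R)"
    "\<And>Z \<alpha>. Z \<in> SM (P \<union> R) \<Longrightarrow> weight_degree (P \<union> R) Z \<alpha> = exp (k \<alpha>)"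
    "\<And>Z \<alpha>. Z \<in> SM (P \<union> R) \<Longrightarrow>
       weight_degree (Q \<union> R) Z \<alpha> = exp (k \<alpha> + (exponent Q Z \<alpha> - exponent P Z \<alpha>))"
    using levelling_context[OF P Q] by blast
  have "lpmln_program {}" by (simp add: lpmln_program_def)
  then have SM: "SM P = SM Q"
    using q unfolding q_strongly_equivalent_def by (metis sup_bot.right_neutral)
  have le: "\<forall>\<^sub>F \<alpha> in at_top. exponent Q X \<alpha> - exponent P X \<alpha> \<le> exponent Q Y \<alpha> - exponent P Y \<alpha>"
    if XY: "X \<in> SM P" "Y \<in> SM P" for X Y
  proof -
    have XY': "X \<in> SM (P \<union> R)" "Y \<in> SM (P \<union> R)" using XY R(3) by auto
    \<comment> \<open>All weights coincide in \<open>P \<union> R\<close>, so this holds for either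
      order of \<open>X\<close> and \<open>Y\<close>.\<close>
    then have "degree_le (weight_degree (P \<union> R) X) (weight_degree (P \<union> R) Y)"
      by (simp add: degree_le_def R(4))
    then have "degree_le (weight_degree (Q \<union> R) X) (weight_degree (Q \<union> R) Y)"
      using q R(1) XY' unfolding q_strongly_equivalent_def by blast
    then show ?thesis using XY' by (simp add: degree_le_def R(5))
  qed
  have "exponent Q X \<alpha> - exponent P X \<alpha> = exponent Q Y \<alpha> - exponent P Y \<alpha>"
    if XY: "X \<in> SM P" "Y \<in> SM P" for X Y \<alpha>
  proof -
    have "\<forall>\<^sub>F \<alpha> in at_top. exponent Q X \<alpha> - exponent P X \<alpha> = exponent Q Y \<alpha> - exponent P Y \<alpha>"
      using le[OF XY] le[OF XY(2,1)] by eventually_elim simp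
    then show ?thesis
      unfolding exponent_diff_eq by (drule_tac eventually_linear_eqD) simp
  qed
  with P Q SM show ?thesis by (rule proportional_if_exponent_diff_eq)
qed

lemma p_strongly_equivalent_imp_proportional:
  fixes P Q :: "('a::infinite) lpmln"
  assumes P: "lpmln_program P" and Q: "lpmln_program Q" and p: "p_strongly_equivalent P Q"
  shows "proportional P Q"
proof -
  obtain R k where R: "lpmln_program R" "SM (P \<union> R) = SM (Q \<union> R)" "SM P \<subseteq> SM (P \<union> R)"
    "\<And>Z \<alpha>. Z \<in> SM (P \<union> R) \<Longrightarrow> weight_degree (P \<union> R) Z \<alpha> = exp (k \<alpha>)"
    "\<And>Z \<alpha>. Z \<in> SM (P \<union> R) \<Longrightarrow>
       weight_degree (Q \<union> R) Z \<alpha> = exp (k \<alpha> + (exponent Q Z \<alpha> - exponent P Z \<alpha>))"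
    using levelling_context[OF P Q] by blast
  have "lpmln_program {}" by (simp add: lpmln_program_def)
  then have SM: "SM P = SM Q"
    using p unfolding p_strongly_equivalent_def by (metis sup_bot.right_neutral)
  define C where "C = SM (P \<union> R)"
  have finC: "finite C"
    unfolding C_def using P R(1) by (intro finite_SM lpmln_program_Un)
  let ?a = "\<lambda>Z. soft_weight Q Z - soft_weight P Z"
  let ?b = "\<lambda>Z. real (hard_count Q Z) - real (hard_count P Z)"
  have lim: "Lim at_top (\<lambda>\<alpha>. exp (?a X + ?b X * \<alpha>) / (\<Sum>Z\<in>C. exp (?a Z + ?b Z * \<alpha>))) = 1 / card C"
    if X: "X \<in> C" for X
  proof -
    \<comment> \<open>All weights are \<open>exp (k \<alpha>)\<close>, so the quotient does not
      depend on \<open>\<alpha>\<close>.\<close>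
    have "prob_degree (P \<union> R) X = Lim at_top (\<lambda>\<alpha>::real. 1 / card C)"
      using X R(4) unfolding C_def by (simp add: prob_degree_def)
    also have "\<dots> = 1 / card C"
      by (intro tendsto_Lim tendsto_const) simp
    finally have "prob_degree (Q \<union> R) X = 1 / card C"
      using p R(1) X unfolding C_def p_strongly_equivalent_def by metis
    \<comment> \<open>The factor \<open>exp (k \<alpha>)\<close> cancels and leaves only the
      exponent differences.\<close>
    moreover have "prob_degree (Q \<union> R) X =
        Lim at_top (\<lambda>\<alpha>. exp (?a X + ?b X * \<alpha>) / (\<Sum>Z\<in>C. exp (?a Z + ?b Z * \<alpha>)))"
      using X R(2,5) unfolding C_def
      by (simp add: prob_degree_def exponent_diff_eq exp_add flip: sum_distrib_left)
    ultimately show ?thesis by simp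
  qed
  have "exponent Q X \<alpha> - exponent P X \<alpha> = exponent Q Y \<alpha> - exponent P Y \<alpha>"
    if "X \<in> SM P" "Y \<in> SM P" for X Y \<alpha>
  proof -
    have "X \<in> C" "Y \<in> C" using that R(3) by (auto simp: C_def)
    from uniform_limits_imp_equal[of C ?a ?b, OF finC lim this]
    show ?thesis by (simp add: exponent_diff_eq)
  qed
  with P Q SM show ?thesis by (rule proportional_if_exponent_diff_eq)
qed

text \<open>A further context merges with \<open>R\<close> into a single one. Hence proportionality
  of equivalent programs by themselves already yields it in every context.\<close>

lemma q_strongly_equivalent_Un:
  "q_strongly_equivalent P Q \<Longrightarrow> lpmln_program R \<Longrightarrow> q_strongly_equivalent (P \<union> R) (Q \<union> R)"
  unfolding q_strongly_equivalent_def by (simp add: Un_assoc lpmln_program_Un)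

lemma p_strongly_equivalent_Un:
  "p_strongly_equivalent P Q \<Longrightarrow> lpmln_program R \<Longrightarrow> p_strongly_equivalent (P \<union> R) (Q \<union> R)"
  unfolding p_strongly_equivalent_def by (simp add: Un_assoc lpmln_program_Un)

theorem theorem3p26:
  fixes P Q :: "('a::infinite) lpmln"
  assumes "lpmln_program P" and "lpmln_program Q"
  shows "q_strongly_equivalent P Q \<longleftrightarrow> p_strongly_equivalent P Q"
proof
  assume q: "q_strongly_equivalent P Q"
  have "proportional (P \<union> R) (Q \<union> R)" if "lpmln_program R" for R
    using assms that q
    by (intro q_strongly_equivalent_imp_proportional q_strongly_equivalent_Un lpmln_program_Un)
  then show "p_strongly_equivalent P Q"
    unfolding p_strongly_equivalent_def
    using assms(1) proportional_imp_prob_degree_eq lpmln_program_Un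
    by (metis proportional_def)
next
  assume p: "p_strongly_equivalent P Q"
  have "proportional (P \<union> R) (Q \<union> R)" if "lpmln_program R" for R
    using assms that p
    by (intro p_strongly_equivalent_imp_proportional p_strongly_equivalent_Un lpmln_program_Un)
  then show "q_strongly_equivalent P Q"
    unfolding q_strongly_equivalent_def
    using proportional_imp_degree_le_iff by (metis proportional_def)
qed

end
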